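(* Let $q,a,b$ be nonzero real numbers with $q\neq\pm1$. On the space of real functions $f(x)$ of a real variable $x\neq0$, consider the operators $$X=(x-q)T^-+(q-bx)\mathcal{I},\quad Y=(x-a^{-1}q)T^++(a^{-1}q-b^{-1}x)\mathcal{I},\quad Z=(1-qx^{-1})T^-+(qx^{-1}-b)\mathcal{I}.$$ Then $$qXY-YX=q(q-1)\left(a^{-1}X+Y\right),$$ $$qYZ-ZY=(q-1)\left(-b^{-1}q^{-1}(1+q)X-bY+a^{-1}qZ+a^{-1}b^{-1}(1-b)(a-bq)\mathcal{I}\right),$$ $$qZX-XZ=(q-1)\left(-bX+qZ\right).$$ Moreover, the affinely transformed operators $$\widetilde X=\frac{a}{bq(q-1)}X-\frac{a}{b(q-1)}\mathcal{I},\qquad \widetilde Y=bq^{-1}Y-a^{-1}b\,\mathcal{I},\qquad \widetilde Z=-a^{-1}Z-a^{-1}b\,\mathcal{I}$$ satisfy $$q\widetilde X\widetilde Y-\widetilde Y\widetilde X=\mathcal{I},\qquad q\widetilde Y\widetilde Z-\widetilde Z\widetilde Y=\alpha_1\widetilde X+\alpha_2\mathcal{I},\qquad q\widetilde Z\widetilde X-\widetilde X\widetilde Z=\mathcal{I},$$ where $\alpha_1=a^{-2}bq^{-1}(q-1)^2(q+1)$ and $\alpha_2=a^{-2}q^{-1}(q-1)(ab+aq+bq)$.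
   Context: $T^{\pm}$ are the $q$-shift operators $T^\pm f(x)=f(q^{\pm1}x)$ and $\mathcal{I}$ is the identity operator; functions of $x$ such as $x$, $x^{-1}$ act by multiplication (so e.g. $(x-q)T^-f(x)=(x-q)f(q^{-1}x)$). Products of operators are compositions. *)

theory Defs
  imports Complex_Main "HOL-Library.Function_Algebras"
begin

text \<open>
  Functions of a nonzero real variable are total functions on the type of nonzero reals, so that
  an identity between operators is an equality in HOL. Sums and differences of operators
  are the pointwise ones of \<^theory>\<open>HOL-Library.Function_Algebras\<close>; products of
  operators are compositions \<open>\<circ>\<close> (not the pointwise \<open>*\<close>), and
  \<open>\<I>\<close> is \<open>id\<close> (not the pointwise \<open>1\<close>).
\<close>

typedef nonzero_real = "{x :: real. x \<noteq> 0}"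
  morphisms real_of_nz nz_of_real
  by (rule exI[of _ 1]) simp

type_synonym nzfun = "nonzero_real \<Rightarrow> real"
type_synonym nzop = "nzfun \<Rightarrow> nzfun"

text \<open>\<open>nz_of_real\<close> is meaningful on nonzero arguments only, so the shifts are
  meaningful for \<open>q \<noteq> 0\<close>.\<close>

definition Tplus :: "real \<Rightarrow> nzop" where
  "Tplus q f = (\<lambda>x. f (nz_of_real (q * real_of_nz x)))"

definition Tminus :: "real \<Rightarrow> nzop" where
  "Tminus q f = (\<lambda>x. f (nz_of_real (inverse q * real_of_nz x)))"

definition mult_op :: "(real \<Rightarrow> real) \<Rightarrow> nzop" where
  "mult_op g f = (\<lambda>x. g (real_of_nz x) * f x)"

definition scale_op :: "real \<Rightarrow> nzop \<Rightarrow> nzop" (infixr \<open>\<cdot>\<close> 75) where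
  "c \<cdot> A = (\<lambda>f x. c * A f x)"

abbreviation id_op :: nzop (\<open>\<I>\<close>) where
  "\<I> \<equiv> id"

definition X_op :: "real \<Rightarrow> real \<Rightarrow> nzop" where
  "X_op q b = (mult_op (\<lambda>x. x - q) \<circ> Tminus q) + (mult_op (\<lambda>x. q - b * x) \<circ> \<I>)"

definition Y_op :: "real \<Rightarrow> real \<Rightarrow> real \<Rightarrow> nzop" where
  "Y_op q a b = (mult_op (\<lambda>x. x - inverse a * q) \<circ> Tplus q)
     + (mult_op (\<lambda>x. inverse a * q - inverse b * x) \<circ> \<I>)"

definition Z_op :: "real \<Rightarrow> real \<Rightarrow> nzop" where
  "Z_op q b = (mult_op (\<lambda>x. 1 - q * inverse x) \<circ> Tminus q)
     + (mult_op (\<lambda>x. q * inverse x - b) \<circ> \<I>)"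

definition Xt_op :: "real \<Rightarrow> real \<Rightarrow> real \<Rightarrow> nzop" where
  "Xt_op q a b = (a / (b * q * (q - 1))) \<cdot> X_op q b - (a / (b * (q - 1))) \<cdot> \<I>"

definition Yt_op :: "real \<Rightarrow> real \<Rightarrow> real \<Rightarrow> nzop" where
  "Yt_op q a b = (b * inverse q) \<cdot> Y_op q a b - (inverse a * b) \<cdot> \<I>"

definition Zt_op :: "real \<Rightarrow> real \<Rightarrow> real \<Rightarrow> nzop" where
  "Zt_op q a b = (- inverse a) \<cdot> Z_op q b - (inverse a * b) \<cdot> \<I>"

end

(* The shifts are mutually inverse ring automorphisms that send x to qx and to x/q. Hence, at a
   point x, each relation becomes an identity between polynomials in f(x/q^2), f(x/q), f(x),
   f(qx), x, q, a, b and the inverses of x, q, a, b, q - 1, modulo the equations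
   saying that these are inverses. *)
theory Submission
  imports Defs
begin

lemma real_of_nz_nonzero [simp]: "real_of_nz x \<noteq> 0"
  using real_of_nz[of x] by simp

lemma real_of_nz_scaled [simp]:
  "c \<noteq> 0 \<Longrightarrow> real_of_nz (nz_of_real (c * real_of_nz x)) = c * real_of_nz x"
  by (simp add: nz_of_real_inverse)

lemma Tplus_Tminus [simp]: "q \<noteq> 0 \<Longrightarrow> Tplus q (Tminus q f) = f"
  and Tminus_Tplus [simp]: "q \<noteq> 0 \<Longrightarrow> Tminus q (Tplus q f) = f"
  by (simp_all add: Tplus_def Tminus_def real_of_nz_inverse flip: mult.assoc)

text \<open>Unfolded as a whole function and not at a point: in a composition the result stands
  under a shift, and the shift rules need its sums and products in view.\<close>

lemma X_op_apply:
  "X_op q b f = (\<lambda>x. (real_of_nz x - q) * Tminus q f x + (q - b * real_of_nz x) * f x)"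
  by (simp add: X_op_def mult_op_def fun_eq_iff)

lemma Y_op_apply:
  "Y_op q a b f = (\<lambda>x. (real_of_nz x - inverse a * q) * Tplus q f x
     + (inverse a * q - inverse b * real_of_nz x) * f x)"
  by (simp add: Y_op_def mult_op_def fun_eq_iff)

lemma Z_op_apply:
  "Z_op q b f = (\<lambda>x. (1 - q * inverse (real_of_nz x)) * Tminus q f x
     + (q * inverse (real_of_nz x) - b) * f x)"
  by (simp add: Z_op_def mult_op_def fun_eq_iff)

text \<open>Substitution commutes with pointwise operations; the last rule is the commutation of the
  shift with \<open>x\<close>. As rewrite rules they push each shift down to \<open>f\<close> and
  \<open>real_of_nz\<close>.\<close>

lemma Tplus_hom [simp]:
  "Tplus q (\<lambda>x. c) y = c"
  "Tplus q (\<lambda>x. f x + g x) y = Tplus q f y + Tplus q g y"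
  "Tplus q (\<lambda>x. f x - g x) y = Tplus q f y - Tplus q g y"
  "Tplus q (\<lambda>x. - f x) y = - Tplus q f y"
  "Tplus q (\<lambda>x. f x * g x) y = Tplus q f y * Tplus q g y"
  "Tplus q (\<lambda>x. inverse (f x)) y = inverse (Tplus q f y)"
  "q \<noteq> 0 \<Longrightarrow> Tplus q real_of_nz y = q * real_of_nz y"
  by (simp_all add: Tplus_def)

lemma Tminus_hom [simp]:
  "Tminus q (\<lambda>x. c) y = c"
  "Tminus q (\<lambda>x. f x + g x) y = Tminus q f y + Tminus q g y"
  "Tminus q (\<lambda>x. f x - g x) y = Tminus q f y - Tminus q g y"
  "Tminus q (\<lambda>x. - f x) y = - Tminus q f y"
  "Tminus q (\<lambda>x. f x * g x) y = Tminus q f y * Tminus q g y"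
  "Tminus q (\<lambda>x. inverse (f x)) y = inverse (Tminus q f y)"
  "q \<noteq> 0 \<Longrightarrow> Tminus q real_of_nz y = inverse q * real_of_nz y"
  by (simp_all add: Tminus_def)

text \<open>Division is split into separate \<open>inverse\<close> factors, the form to which the
  shift rules and the equations for inverses apply.\<close>

lemma Xt_op_apply:
  "Xt_op q a b f = (\<lambda>x. a * inverse b * inverse q * inverse (q - 1) * X_op q b f x
     - a * inverse b * inverse (q - 1) * f x)"
  by (simp add: Xt_op_def scale_op_def fun_eq_iff divide_inverse)

lemma Yt_op_apply: "Yt_op q a b f = (\<lambda>x. b * inverse q * Y_op q a b f x - inverse a * b * f x)"
  by (simp add: Yt_op_def scale_op_def fun_eq_iff)

lemma Zt_op_apply: "Zt_op q a b f = (\<lambda>x. - inverse a * Z_op q b f x - inverse a * b * f x)"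
  by (simp add: Zt_op_def scale_op_def fun_eq_iff)

lemmas operator_apply = scale_op_def
  X_op_apply Y_op_apply Z_op_apply Xt_op_apply Yt_op_apply Zt_op_apply

context
  fixes q a b :: real
  assumes nz: "q \<noteq> 0" "a \<noteq> 0" "b \<noteq> 0"
begin

lemma inverses:
  "q * inverse q = 1" "a * inverse a = 1" "b * inverse b = 1"
  "real_of_nz x * inverse (real_of_nz x) = 1"
  using nz by simp_all

lemma X_Y_relation:
  "q \<cdot> (X_op q b \<circ> Y_op q a b) - (Y_op q a b \<circ> X_op q b) =
    (q * (q - 1)) \<cdot> (inverse a \<cdot> X_op q b + Y_op q a b)"
  (is "?L = ?R")
proof (intro ext)
  fix f :: nzfun and x
  show "?L f x = ?R f x"
    using inverses(1-3) inverses(4)[of x]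
    \<comment> \<open>The chained equations pass through \<open>simp\<close> too; with the inverse
      rules active they would collapse to \<open>True\<close> before \<open>algebra\<close> could
      use them.\<close>
    by (simp add: nz operator_apply del: right_inverse left_inverse) algebra
qed

lemma Y_Z_relation:
  "q \<cdot> (Y_op q a b \<circ> Z_op q b) - (Z_op q b \<circ> Y_op q a b) =
    (q - 1) \<cdot> ((- inverse b * inverse q * (1 + q)) \<cdot> X_op q b - b \<cdot> Y_op q a b
      + (inverse a * q) \<cdot> Z_op q b
      + (inverse a * inverse b * (1 - b) * (a - b * q)) \<cdot> \<I>)"
  (is "?L = ?R")
proof (intro ext)
  fix f :: nzfun and x
  show "?L f x = ?R f x"
    using inverses(1-3) inverses(4)[of x]
    by (simp add: nz operator_apply del: right_inverse left_inverse) algebra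
qed

text \<open>Here Z = x^(-1) X. As T^- x^(-1) = q x^(-1) T^-, the shift terms of q x^(-1) X - X
  x^(-1) cancel and leave multiplication by (q - 1)(q x^(-1) - b); composing with X gives the right
  side.\<close>

lemma Z_X_relation:
  "q \<cdot> (Z_op q b \<circ> X_op q b) - (X_op q b \<circ> Z_op q b) =
    (q - 1) \<cdot> ((- b) \<cdot> X_op q b + q \<cdot> Z_op q b)"
  (is "?L = ?R")
proof (intro ext)
  fix f :: nzfun and x
  show "?L f x = ?R f x"
    using inverses(1-3) inverses(4)[of x]
    by (simp add: nz operator_apply del: right_inverse left_inverse) algebra
qed

context
  assumes "q \<noteq> 1"
begin

lemma inverse_q_minus_1: "(q - 1) * inverse (q - 1) = 1"
  using \<open>q \<noteq> 1\<close> by simp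

text \<open>\<open>Xt_op\<close> and \<open>Yt_op\<close> are multiples of X - q and Y - q/a. These
  shifts absorb the linear terms of the relation for X and Y, and the scalar left over is normalised
  to 1.\<close>

lemma Xt_Yt_relation:
  "q \<cdot> (Xt_op q a b \<circ> Yt_op q a b) - (Yt_op q a b \<circ> Xt_op q a b) = \<I>"
  (is "?L = ?R")
proof (intro ext)
  fix f :: nzfun and x
  show "?L f x = ?R f x"
    using inverses(1-3) inverses(4)[of x] inverse_q_minus_1
    by (simp add: nz operator_apply del: right_inverse left_inverse) algebra
qed

text \<open>The shifts Y - q/a and Z + b cancel the terms in Y and Z, but the one in X survives.
  Rewriting X through \<open>Xt_op\<close> splits it between the two coefficients.\<close>

lemma Yt_Zt_relation:
  "q \<cdot> (Yt_op q a b \<circ> Zt_op q a b) - (Zt_op q a b \<circ> Yt_op q a b) =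
    ((inverse a)\<^sup>2 * b * inverse q * (q - 1)\<^sup>2 * (q + 1)) \<cdot> Xt_op q a b +
    ((inverse a)\<^sup>2 * inverse q * (q - 1) * (a * b + a * q + b * q)) \<cdot> \<I>"
  (is "?L = ?R")
proof (intro ext)
  fix f :: nzfun and x
  show "?L f x = ?R f x"
    using inverses(1-3) inverses(4)[of x] inverse_q_minus_1
    by (simp add: nz operator_apply del: right_inverse left_inverse) algebra
qed

lemma Zt_Xt_relation:
  "q \<cdot> (Zt_op q a b \<circ> Xt_op q a b) - (Xt_op q a b \<circ> Zt_op q a b) = \<I>"
  (is "?L = ?R")
proof (intro ext)
  fix f :: nzfun and x
  show "?L f x = ?R f x"
    using inverses(1-3) inverses(4)[of x] inverse_q_minus_1
    by (simp add: nz operator_apply del: right_inverse left_inverse) algebra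
qed

end

end

theorem mainTheorem4:
  fixes q a b :: real
    and X Y Z Xt Yt Zt :: nzop
    and \<alpha>\<^sub>1 \<alpha>\<^sub>2 :: real
  assumes "q \<noteq> 0" and "a \<noteq> 0" and "b \<noteq> 0" and "q \<noteq> 1" and "q \<noteq> -1"
  defines "X \<equiv> X_op q b" and "Y \<equiv> Y_op q a b" and "Z \<equiv> Z_op q b"
    and "Xt \<equiv> Xt_op q a b" and "Yt \<equiv> Yt_op q a b" and "Zt \<equiv> Zt_op q a b"
    and "\<alpha>\<^sub>1 \<equiv> (inverse a)\<^sup>2 * b * inverse q * (q - 1)\<^sup>2 * (q + 1)"
    and "\<alpha>\<^sub>2 \<equiv> (inverse a)\<^sup>2 * inverse q * (q - 1) * (a * b + a * q + b * q)"
  shows "q \<cdot> (X \<circ> Y) - (Y \<circ> X) = (q * (q - 1)) \<cdot> (inverse a \<cdot> X + Y)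
    \<and> q \<cdot> (Y \<circ> Z) - (Z \<circ> Y) =
        (q - 1) \<cdot> ((- inverse b * inverse q * (1 + q)) \<cdot> X - b \<cdot> Y + (inverse a * q) \<cdot> Z
          + (inverse a * inverse b * (1 - b) * (a - b * q)) \<cdot> \<I>)
    \<and> q \<cdot> (Z \<circ> X) - (X \<circ> Z) = (q - 1) \<cdot> ((- b) \<cdot> X + q \<cdot> Z)
    \<and> q \<cdot> (Xt \<circ> Yt) - (Yt \<circ> Xt) = \<I>
    \<and> q \<cdot> (Yt \<circ> Zt) - (Zt \<circ> Yt) = \<alpha>\<^sub>1 \<cdot> Xt + \<alpha>\<^sub>2 \<cdot> \<I>
    \<and> q \<cdot> (Zt \<circ> Xt) - (Xt \<circ> Zt) = \<I>"
  \<comment> \<open>\<open>assms(6-)\<close> are the defining equations of the abbreviated operators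
    and coefficients.\<close>
  unfolding assms(6-)
  using assms(1-4)
  by (intro conjI X_Y_relation Y_Z_relation Z_X_relation
      Xt_Yt_relation Yt_Zt_relation Zt_Xt_relation)

end
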